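(* Let $\mathsf{P}$ be a poset on $[n]$ and let $\mathsf{P}^{op}$ be the opposite poset. Then $$F_q(C(\mathsf{P}^{op}))=\mathrm{rev}\big(F_q(C(\mathsf{P}))\big).$$
   Context: For a poset $\mathsf{P}$ on $[n]=\{1,\ldots,n\}$ the poset cone is $C(\mathsf{P})=\mathrm{cone}\{e_i-e_j:i<_\mathsf{P}j\}\subseteq\mathbb{R}^n$, with $e_1,\ldots,e_n$ the standard basis. For a nonempty face $G$ of $C(\mathsf{P})$ (including $C(\mathsf{P})$ itself), $C_G^\circ$ is the relative interior of the normal cone at $G$, i.e. the set of $\omega\in\mathbb{R}^n$ such that $x\mapsto\langle\omega,x\rangle$ attains a maximum on $C(\mathsf{P})$ with set of maximizers exactly $G$. The weighted quasisymmetric enumerator is $$F_q(C(\mathsf{P}))=\sum_{G}q^{\dim G}\sum_{\omega\in\mathbb{Z}^n_+\cap C_G^\circ}x_{\omega_1}\cdots x_{\omega_n},$$ the sum being over nonempty faces $G$, with $\mathbb{Z}^n_+$ the vectors of positive integers and $q$ an indeterminate; it is a linear combination of monomial quasisymmetric functions $M_\alpha=\sum_{i_1<\cdots<i_k}x_{i_1}^{\alpha_1}\cdots x_{i_k}^{\alpha_k}$ indexed by compositions $\alpha=(\alpha_1,\ldots,\alpha_k)$ of $n$. The opposite poset $\mathsf{P}^{op}$ is the poset on the same set with $i<_{\mathsf{P}^{op}}j$ if and only if $j<_\mathsf{P}i$. For a composition, $\mathrm{rev}(\alpha_1,\ldots,\alpha_k)=(\alpha_k,\ldots,\alpha_1)$,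 and $F\mapsto\mathrm{rev}(F)$ is the linear map on quasisymmetric functions with $M_\alpha\mapsto M_{\mathrm{rev}(\alpha)}$. *)

theory Defs
  imports
    "HOL-Analysis.Analysis"
    "HOL-Computational_Algebra.Polynomial"
    "HOL-Library.Multiset"
    "HOL-Library.Function_Algebras"
begin

section \<open>Poset cones and normal cones\<close>

text \<open>A poset on the ground set is a reflexive partial order \<open>P\<close> on the finite index type \<open>'n\<close>;
  the strict relation is \<open>(i, j) \<in> P \<and> i \<noteq> j\<close>. The convex cone hull always contains 0, so
  the cone of the empty set of generators (antichain) is \<open>{0}\<close>.\<close>

definition poset_cone :: "'n::finite rel \<Rightarrow> (real ^ 'n) set" where
  "poset_cone P = convex_cone hull {axis i 1 - axis j 1 | i j. (i, j) \<in> P \<and> i \<noteq> j}"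

definition normal_cone :: "'a::euclidean_space set \<Rightarrow> 'a set \<Rightarrow> 'a set" where
  "normal_cone C G = {w. \<forall>x\<in>G. \<forall>y\<in>C. w \<bullet> y \<le> w \<bullet> x}"

definition open_normal_cone :: "'a::euclidean_space set \<Rightarrow> 'a set \<Rightarrow> 'a set" where
  "open_normal_cone C G = rel_interior (normal_cone C G)"

text \<open>For the cones used here, the relative interior of the normal cone at a nonempty face \<open>G\<close>
  consists of the functionals whose set of maximizers is exactly \<open>G\<close>.\<close>

lemma convex_normal_cone: "convex (normal_cone C G)"
proof -
  have eq: "normal_cone C G = (\<Inter>x\<in>G. \<Inter>y\<in>C. {w. (y - x) \<bullet> w \<le> 0})"
    by (auto simp: normal_cone_def inner_diff_left inner_diff_right inner_commute)
  show ?thesis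
    unfolding eq by (intro convex_INT convex_halfspace_le)
qed

lemma open_normal_cone_eq_maximizers:
  fixes S :: "'a::euclidean_space set"
  assumes "finite S" and C: "C = convex_cone hull S"
    and face: "G face_of C" and ne: "G \<noteq> {}"
  shows "open_normal_cone C G = {w. {x \<in> C. \<forall>y\<in>C. w \<bullet> y \<le> w \<bullet> x} = G}"
proof -
  have poly: "polyhedron C"
    unfolding C by (rule polyhedron_convex_cone_hull[OF \<open>finite S\<close>])
  have GC: "G \<subseteq> C" using face by (rule face_of_imp_subset)
  have cone0: "0 \<in> C" unfolding C by (rule convex_cone_hull_contains_0)
  have cone2: "2 *\<^sub>R x \<in> C" if "x \<in> C" for x
    using that unfolding C by (rule convex_cone_hull_mul) simp
  have zero: "w \<bullet> g = 0" if "g \<in> C" "\<forall>y\<in>C. w \<bullet> y \<le> w \<bullet> g" for w g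
  proof -
    have "w \<bullet> (2 *\<^sub>R g) \<le> w \<bullet> g" "w \<bullet> 0 \<le> w \<bullet> g"
      using that cone0 cone2 by blast+
    then show ?thesis by simp
  qed
  have N: "normal_cone C G = {w. (\<forall>y\<in>C. w \<bullet> y \<le> 0) \<and> (\<forall>g\<in>G. w \<bullet> g = 0)}"
  proof (intro equalityI subsetI)
    fix w assume "w \<in> normal_cone C G"
    then have w: "\<forall>y\<in>C. w \<bullet> y \<le> w \<bullet> g" if "g \<in> G" for g
      using that unfolding normal_cone_def by blast
    have "w \<bullet> g = 0" if "g \<in> G" for g
      using zero[of g w] w[OF that] GC that by blast
    with w ne show "w \<in> {w. (\<forall>y\<in>C. w \<bullet> y \<le> 0) \<and> (\<forall>g\<in>G. w \<bullet> g = 0)}"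
      by fastforce
  qed (auto simp: normal_cone_def)
  have M: "{x \<in> C. \<forall>y\<in>C. w \<bullet> y \<le> w \<bullet> x} = G \<longleftrightarrow>
      (\<forall>y\<in>C. w \<bullet> y \<le> 0) \<and> G = {x \<in> C. w \<bullet> x = 0}" (is "?A = G \<longleftrightarrow> ?R") for w
  proof
    assume A: "?A = G"
    obtain g where "g \<in> G" using ne by blast
    then have g: "g \<in> C" "\<forall>y\<in>C. w \<bullet> y \<le> w \<bullet> g" using A by blast+
    have "w \<bullet> g = 0" using zero g by blast
    then have le: "\<forall>y\<in>C. w \<bullet> y \<le> 0" using g by simp
    have "?A = {x \<in> C. w \<bullet> x = 0}"
      using zero le by auto
    with A le show ?R by blast
  next
    assume ?R
    moreover have "?A = {x \<in> C. w \<bullet> x = 0}"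
      using zero \<open>?R\<close> by auto
    ultimately show "?A = G" by simp
  qed
  have N_ne: "normal_cone C G \<noteq> {}"
    by (auto simp: normal_cone_def intro: exI[of _ 0])
  have "G exposed_face_of C"
    using exposed_face_of_polyhedron[OF poly] face by blast
  then obtain a b where ab: "C \<subseteq> {x. a \<bullet> x \<le> b}" "G = C \<inter> {x. a \<bullet> x = b}"
    unfolding exposed_face_of_def by blast
  then have "{x \<in> C. \<forall>y\<in>C. a \<bullet> y \<le> a \<bullet> x} = G"
    using ne by fastforce
  then have a: "\<forall>y\<in>C. a \<bullet> y \<le> 0" "G = {x \<in> C. a \<bullet> x = 0}"
    using M by blast+
  then have aN: "a \<in> normal_cone C G" unfolding N by blast
  show ?thesis
    unfolding open_normal_cone_def
  proof (intro equalityI subsetI)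
    fix w assume w: "w \<in> rel_interior (normal_cone C G)"
    then have wN: "w \<in> normal_cone C G" using rel_interior_subset by blast
    obtain e where e: "e > 1" "(1 - e) *\<^sub>R a + e *\<^sub>R w \<in> normal_cone C G"
      using convex_rel_interior_iff[OF convex_normal_cone N_ne] w aN by blast
    have "x \<in> G" if "x \<in> C" "w \<bullet> x = 0" for x
    proof -
      have "((1 - e) *\<^sub>R a + e *\<^sub>R w) \<bullet> x \<le> 0" using e(2) that(1) unfolding N by blast
      then have "(1 - e) * (a \<bullet> x) \<le> 0" using that(2) by (simp add: inner_add_left)
      then have "a \<bullet> x \<ge> 0" using e(1) by (simp add: mult_le_0_iff)
      with a that(1) show ?thesis by force
    qed
    then have "G = {x \<in> C. w \<bullet> x = 0}" using wN GC unfolding N by blast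
    with wN show "w \<in> {w. {x \<in> C. \<forall>y\<in>C. w \<bullet> y \<le> w \<bullet> x} = G}"
      unfolding N mem_Collect_eq M by blast
  next
    fix w assume "w \<in> {w. {x \<in> C. \<forall>y\<in>C. w \<bullet> y \<le> w \<bullet> x} = G}"
    then have w: "\<forall>y\<in>C. w \<bullet> y \<le> 0" "G = {x \<in> C. w \<bullet> x = 0}"
      unfolding mem_Collect_eq M by blast+
    have SC: "S \<subseteq> C" unfolding C by (rule hull_subset)
    have "\<exists>e>1. (1 - e) *\<^sub>R u + e *\<^sub>R w \<in> normal_cone C G" if u: "u \<in> normal_cone C G" for u
    proof -
      have "\<exists>d>0. \<forall>v\<in>T. w \<bullet> v < 0 \<longrightarrow> d * - (u \<bullet> v) \<le> - (w \<bullet> v)"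
        if "finite T" for T
        using that
      proof (induction T)
        case empty
        show ?case by (auto intro: exI[of _ 1])
      next
        case (insert t T)
        then obtain d where d: "d > 0" "\<forall>v\<in>T. w \<bullet> v < 0 \<longrightarrow> d * - (u \<bullet> v) \<le> - (w \<bullet> v)"
          by blast
        define d' where "d' = (if w \<bullet> t < 0 then min d (- (w \<bullet> t) / (\<bar>u \<bullet> t\<bar> + 1)) else d)"
        have "d' > 0" "d' \<le> d"
          using d(1) by (auto simp: d'_def add_nonneg_pos intro: divide_neg_pos)
        moreover have "d' * - (u \<bullet> t) \<le> - (w \<bullet> t)" if "w \<bullet> t < 0"
        proof -
          have "d' * - (u \<bullet> t) \<le> d' * (\<bar>u \<bullet> t\<bar> + 1)"
            using \<open>d' > 0\<close> by (intro mult_left_mono) auto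
          also have "\<dots> \<le> (- (w \<bullet> t) / (\<bar>u \<bullet> t\<bar> + 1)) * (\<bar>u \<bullet> t\<bar> + 1)"
            using that by (intro mult_right_mono) (auto simp: d'_def)
          also have "\<dots> = - (w \<bullet> t)"
            by (simp add: add_nonneg_pos less_imp_neq[symmetric] field_simps)
          finally show ?thesis .
        qed
        moreover have "d' * - (u \<bullet> v) \<le> - (w \<bullet> v)" if v: "v \<in> T" "w \<bullet> v < 0" for v
        proof (cases "- (u \<bullet> v) \<le> 0")
          case True
          then have "d' * - (u \<bullet> v) \<le> 0" using \<open>d' > 0\<close> by (simp add: mult_nonneg_nonpos)
          then show ?thesis using v(2) by linarith
        next
          case False
          then have "d' * - (u \<bullet> v) \<le> d * - (u \<bullet> v)"
            using \<open>d' \<le> d\<close> by (intro mult_right_mono) auto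
          also have "\<dots> \<le> - (w \<bullet> v)" using d(2) v by blast
          finally show ?thesis .
        qed
        ultimately show ?case by (intro exI[of _ d']) blast
      qed
      from this[OF \<open>finite S\<close>] obtain d
        where d: "d > 0" "\<forall>v\<in>S. w \<bullet> v < 0 \<longrightarrow> d * - (u \<bullet> v) \<le> - (w \<bullet> v)"
        by blast
      define z where "z = (1 - (1 + d)) *\<^sub>R u + (1 + d) *\<^sub>R w"
      have zi: "z \<bullet> x = w \<bullet> x + d * (w \<bullet> x) + d * - (u \<bullet> x)" for x
        unfolding z_def by (simp add: inner_add_left algebra_simps)
      have zG: "z \<bullet> g = 0" if "g \<in> G" for g
        using that u w unfolding zi N by auto
      have "z \<bullet> v \<le> 0" if "v \<in> S" for v
      proof (cases "w \<bullet> v < 0")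
        case True
        then have "d * - (u \<bullet> v) \<le> - (w \<bullet> v)" using d(2) that by blast
        moreover have "d * (w \<bullet> v) \<le> 0" using d(1) True by (simp add: mult_nonneg_nonpos)
        ultimately show ?thesis unfolding zi by linarith
      next
        case False
        then have "v \<in> G" using w SC that by force
        then show ?thesis using zG by simp
      qed
      then have "S \<subseteq> {x. z \<bullet> x \<le> 0}" by blast
      moreover have "convex_cone {x. z \<bullet> x \<le> 0}"
        unfolding convex_cone_def
        by (auto simp: convex_halfspace_le conic_halfspace_le intro: exI[of _ 0])
      ultimately have "C \<subseteq> {x. z \<bullet> x \<le> 0}" unfolding C by (rule hull_minimal)
      with zG have "z \<in> normal_cone C G" unfolding N by blast
      with d(1) show ?thesis unfolding z_def by (intro exI[of _ "1 + d"]) simp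
    qed
    then show "w \<in> rel_interior (normal_cone C G)"
      using convex_rel_interior_iff[OF convex_normal_cone N_ne] by blast
  qed
qed


section \<open>Formal power series and quasisymmetric functions\<close>

text \<open>A formal power series in \<open>x\<^sub>1, x\<^sub>2, \<dots>\<close> over \<open>\<int>[q]\<close> is given by its coefficients; the monomial
  \<open>x\<^bsub>i1\<^esub> \<cdots> x\<^bsub>ir\<^esub>\<close> is the multiset of indices \<open>{#i1, \<dots>, ir#}\<close>. Addition is pointwise
  (the pointwise multiplication on functions is not the product of series and is never used).
  Indices are natural numbers, but the index 0 never occurs in the series below.\<close>

type_synonym qseries = "nat multiset \<Rightarrow> int poly"

definition qscale :: "int poly \<Rightarrow> qseries \<Rightarrow> qseries" where
  "qscale c F = (\<lambda>m. c * F m)"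

interpretation qser: module qscale
  by unfold_locales (simp_all add: qscale_def fun_eq_iff algebra_simps)

text \<open>The possibly infinite formal sum of the monomials \<open>f a\<close> over \<open>a \<in> A\<close>; all fibres of \<open>f\<close> on
  \<open>A\<close> are finite in the uses below.\<close>

definition monomial_sum :: "('a \<Rightarrow> nat multiset) \<Rightarrow> 'a set \<Rightarrow> qseries" where
  "monomial_sum f A = (\<lambda>m. of_nat (card {a \<in> A. f a = m}))"

definition composition :: "nat list \<Rightarrow> bool" where
  "composition \<alpha> \<longleftrightarrow> (\<forall>a \<in> set \<alpha>. 0 < a)"

definition power_monomial :: "nat list \<Rightarrow> nat list \<Rightarrow> nat multiset" where
  "power_monomial \<alpha> is = (\<Sum>(i, a) \<leftarrow> zip is \<alpha>. replicate_mset a i)"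

definition monomial_qsym :: "nat list \<Rightarrow> qseries" where
  "monomial_qsym \<alpha> = monomial_sum (power_monomial \<alpha>)
     {is. length is = length \<alpha> \<and> sorted_wrt (<) is \<and> (\<forall>i \<in> set is. 0 < i)}"

definition qsym_basis :: "qseries set" where
  "qsym_basis = monomial_qsym ` {\<alpha>. composition \<alpha>}"

text \<open>The \<open>M\<^sub>\<alpha>\<close> are linearly independent: \<open>M\<^sub>\<beta>\<close> has coefficient \<open>\<delta>\<^bsub>\<alpha>\<beta>\<^esub>\<close> at the monomial
  \<open>x\<^sub>1\<^bsup>\<alpha>1\<^esup> \<cdots> x\<^sub>k\<^bsup>\<alpha>k\<^esup>\<close>.\<close>

lemma set_power_monomial:
  assumes "composition \<alpha>" "length is = length \<alpha>"
  shows "set_mset (power_monomial \<alpha> is) = set is"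
  using assms(2,1)
  by (induction "is" \<alpha> rule: list_induct2) (auto simp: power_monomial_def composition_def)

lemma power_monomial_inj:
  assumes "length is = length \<alpha>" "length is = length \<beta>" "distinct is"
    and "power_monomial \<alpha> is = power_monomial \<beta> is"
  shows "\<alpha> = \<beta>"
proof (rule nth_equalityI)
  have *: "count (power_monomial \<gamma> is) (is ! k) = \<gamma> ! k"
    if "length is = length \<gamma>" "distinct is" "k < length is" for \<gamma> k
    using that
  proof (induction "is" \<gamma> arbitrary: k rule: list_induct2)
    case (Cons i "is" c \<gamma>)
    have z: "count (power_monomial \<gamma> is) i = 0"
    proof -
      have "set_mset (power_monomial \<gamma> is) \<subseteq> set is"
        using Cons.hyps by (induction "is" \<gamma> rule: list_induct2)
          (auto simp: power_monomial_def)
      then show ?thesis using Cons.prems by (auto simp: count_eq_zero_iff)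
    qed
    show ?case
    proof (cases k)
      case 0
      then show ?thesis using z by (simp add: power_monomial_def)
    next
      case (Suc l)
      then have "is ! l \<noteq> i" using Cons.prems by auto
      then show ?thesis using Cons Suc by (simp add: power_monomial_def)
    qed
  qed simp
  show "length \<alpha> = length \<beta>" using assms by simp
  show "\<alpha> ! k = \<beta> ! k" if "k < length \<alpha>" for k
    using *[of \<alpha> k] *[of \<beta> k] assms that by simp
qed

lemma monomial_qsym_packed:
  assumes \<alpha>: "composition \<alpha>" and \<beta>: "composition \<beta>"
  shows "monomial_qsym \<beta> (power_monomial \<alpha> [1..<Suc (length \<alpha>)]) = (if \<alpha> = \<beta> then 1 else 0)"
proof -
  let ?p = "[1..<Suc (length \<alpha>)]"
  have "is = ?p \<and> \<alpha> = \<beta>"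
    if l: "length is = length \<beta>" and s: "sorted_wrt (<) is"
      and e: "power_monomial \<beta> is = power_monomial \<alpha> ?p" for "is"
  proof -
    have "set is = set ?p"
      using set_power_monomial[OF \<beta> l] set_power_monomial[OF \<alpha>, of ?p] e
      by (simp del: upt_Suc set_upt)
    then have eq: "is = ?p"
      using s strict_sorted_equal[of "is" ?p] by (simp del: upt_Suc)
    have len: "length ?p = length \<alpha>" by (simp del: upt_Suc)
    have "length ?p = length \<beta>" using l unfolding eq .
    then have "\<alpha> = \<beta>"
      using power_monomial_inj[OF len] e distinct_upt unfolding eq by metis
    with eq show ?thesis by blast
  qed
  then have "{is \<in> {is. length is = length \<beta> \<and> sorted_wrt (<) is \<and> (\<forall>i \<in> set is. 0 < i)}.
      power_monomial \<beta> is = power_monomial \<alpha> ?p} \<subseteq> (if \<alpha> = \<beta> then {?p} else {})"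
    (is "?L \<subseteq> ?R")
    by auto
  moreover have "?R \<subseteq> ?L"
    by (simp del: upt_Suc add: strict_sorted_iff)
  ultimately have "?L = ?R" by (rule equalityI)
  then show ?thesis
    unfolding monomial_qsym_def monomial_sum_def by (simp del: upt_Suc)
qed

lemma inj_on_monomial_qsym: "inj_on monomial_qsym {\<alpha>. composition \<alpha>}"
  by (rule inj_onI) (metis mem_Collect_eq monomial_qsym_packed zero_neq_one)

lemma sum_qseries_apply: "(\<Sum>a\<in>A. f a) m = (\<Sum>a\<in>A. f a (m :: nat multiset) :: int poly)"
  by (induction A rule: infinite_finite_induct) auto

lemma independent_qsym_basis: "qser.independent qsym_basis"
  unfolding qser.independent_explicit_module
proof (intro allI impI)
  fix t u b
  assume t: "finite t" "t \<subseteq> qsym_basis" "(\<Sum>v\<in>t. qscale (u v) v) = 0" "b \<in> t"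
  then obtain \<alpha> where \<alpha>: "composition \<alpha>" "b = monomial_qsym \<alpha>"
    unfolding qsym_basis_def by blast
  let ?m = "power_monomial \<alpha> [1..<Suc (length \<alpha>)]"
  have "v ?m = (if v = b then 1 else 0)" if "v \<in> t" for v
  proof -
    obtain \<beta> where "composition \<beta>" "v = monomial_qsym \<beta>"
      using \<open>v \<in> t\<close> \<open>t \<subseteq> qsym_basis\<close> unfolding qsym_basis_def by auto
    then show ?thesis using monomial_qsym_packed \<alpha> by (metis zero_neq_one)
  qed
  then have "u v * v ?m = (if v = b then u v else 0)" if "v \<in> t" for v
    using that by (metis mult.right_neutral mult_zero_right)
  then have "(\<Sum>v\<in>t. u v * v ?m) = (\<Sum>v\<in>t. if v = b then u v else 0)"
    by (intro sum.cong refl)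
  also have "\<dots> = u b" using t by simp
  finally have "(\<Sum>v\<in>t. qscale (u v) v) ?m = u b"
    unfolding sum_qseries_apply qscale_def .
  then show "u b = 0" using t(3) by simp
qed

definition qsym :: "qseries set" where
  "qsym = qser.span qsym_basis"

definition qsym_coeff :: "qseries \<Rightarrow> nat list \<Rightarrow> int poly" where
  "qsym_coeff F \<alpha> = qser.representation qsym_basis F (monomial_qsym \<alpha>)"

text \<open>The linear extension of \<open>M\<^sub>\<alpha> \<mapsto> M\<^bsub>rev \<alpha>\<^esub>\<close>; it is meaningful on \<^const>\<open>qsym\<close> only,
  and 0 elsewhere.\<close>

definition qsym_rev :: "qseries \<Rightarrow> qseries" where
  "qsym_rev F = (\<Sum>\<alpha> | composition \<alpha> \<and> qsym_coeff F \<alpha> \<noteq> 0.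
     qscale (qsym_coeff F \<alpha>) (monomial_qsym (rev \<alpha>)))"

text \<open>The lemmas below confirm that \<^const>\<open>qsym_rev\<close> is linear on \<^const>\<open>qsym\<close> and has the
  prescribed values on the basis.\<close>

lemma finite_qsym_coeff: "finite {\<alpha>. composition \<alpha> \<and> qsym_coeff F \<alpha> \<noteq> 0}"
proof -
  have "finite (monomial_qsym -` {b. qser.representation qsym_basis F b \<noteq> 0} \<inter> {\<alpha>. composition \<alpha>})"
    by (intro finite_vimage_IntI qser.finite_representation inj_on_monomial_qsym)
  then show ?thesis
    by (rule rev_finite_subset) (auto simp: qsym_coeff_def)
qed

lemma qsym_rev_superset:
  assumes "finite A" "A \<subseteq> {\<alpha>. composition \<alpha>}" "{\<alpha>. composition \<alpha> \<and> qsym_coeff F \<alpha> \<noteq> 0} \<subseteq> A"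
  shows "qsym_rev F = (\<Sum>\<alpha>\<in>A. qscale (qsym_coeff F \<alpha>) (monomial_qsym (rev \<alpha>)))"
  unfolding qsym_rev_def using assms
  by (intro sum.mono_neutral_left) auto

lemma qsym_rev_monomial_qsym:
  assumes "composition \<alpha>"
  shows "qsym_rev (monomial_qsym \<alpha>) = monomial_qsym (rev \<alpha>)"
proof -
  have c: "qsym_coeff (monomial_qsym \<alpha>) \<beta> = (if \<beta> = \<alpha> then 1 else 0)" if "composition \<beta>" for \<beta>
    using that assms inj_onD[OF inj_on_monomial_qsym, of \<alpha> \<beta>]
    by (auto simp: qsym_coeff_def qsym_basis_def
        qser.representation_basis[OF independent_qsym_basis[unfolded qsym_basis_def]])
  then show ?thesis
    using assms by (subst qsym_rev_superset[of "{\<alpha>}"]) (auto split: if_splits)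
qed

lemma qsym_rev_add:
  assumes "F \<in> qsym" "G \<in> qsym"
  shows "qsym_rev (F + G) = qsym_rev F + qsym_rev G"
proof -
  let ?A = "\<Union>H\<in>{F, G, F + G}. {\<alpha>. composition \<alpha> \<and> qsym_coeff H \<alpha> \<noteq> 0}"
  have "qsym_coeff (F + G) \<alpha> = qsym_coeff F \<alpha> + qsym_coeff G \<alpha>" for \<alpha>
    using assms unfolding qsym_coeff_def qsym_def
    by (simp add: qser.representation_add[OF independent_qsym_basis])
  moreover have "qsym_rev H = (\<Sum>\<alpha>\<in>?A. qscale (qsym_coeff H \<alpha>) (monomial_qsym (rev \<alpha>)))"
    if "H \<in> {F, G, F + G}" for H
    using that by (intro qsym_rev_superset) (auto simp: finite_qsym_coeff)
  ultimately show ?thesis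
    by (simp add: qser.scale_left_distrib sum.distrib)
qed

lemma qsym_rev_scale:
  assumes "F \<in> qsym"
  shows "qsym_rev (qscale c F) = qscale c (qsym_rev F)"
proof -
  let ?A = "\<Union>H\<in>{F, qscale c F}. {\<alpha>. composition \<alpha> \<and> qsym_coeff H \<alpha> \<noteq> 0}"
  have "qsym_coeff (qscale c F) \<alpha> = c * qsym_coeff F \<alpha>" for \<alpha>
    using assms unfolding qsym_coeff_def qsym_def
    by (simp add: qser.representation_scale[OF independent_qsym_basis])
  moreover have "qsym_rev H = (\<Sum>\<alpha>\<in>?A. qscale (qsym_coeff H \<alpha>) (monomial_qsym (rev \<alpha>)))"
    if "H \<in> {F, qscale c F}" for H
    using that by (intro qsym_rev_superset) (auto simp: finite_qsym_coeff)
  ultimately show ?thesis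
    by (simp add: qser.scale_sum_right)
qed


section \<open>The weighted quasisymmetric enumerator\<close>

definition vec_monomial :: "nat ^ 'n::finite \<Rightarrow> nat multiset" where
  "vec_monomial w = (\<Sum>i\<in>UNIV. {#w $ i#})"

definition weighted_enumerator :: "(real ^ 'n::finite) set \<Rightarrow> qseries" where
  "weighted_enumerator C = (\<Sum>G | G face_of C \<and> G \<noteq> {}.
     qscale (monom 1 (nat (aff_dim G)))
       (monomial_sum vec_monomial
         {w. (\<forall>i. 0 < w $ i) \<and> (\<chi> i. real (w $ i)) \<in> open_normal_cone C G}))"

end

theory Submission
  imports Defs
begin

text \<open>
  The generators of \<open>C(P)\<close> are differences \<open>e\<^sub>i - e\<^sub>j\<close>, so whether \<open>\<omega>\<close> lies in \<open>C\<^sub>G\<degree>\<close> depends only on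
  the relative order of the coordinates of \<open>\<omega>\<close>. Hence the contribution of each face \<open>G\<close> is a combination
  of the \<open>M\<^sub>\<alpha>\<close>, and the coefficient of \<open>M\<^sub>\<alpha>\<close> counts the \<open>\<omega>\<close> of the open normal cone whose monomial is
  \<open>x\<^sub>1\<^bsup>\<alpha>1\<^esup> \<cdots> x\<^sub>k\<^bsup>\<alpha>k\<^esup>\<close>. Passing to the opposite poset negates the cone, its faces and their open normal
  cones. On the counted \<open>\<omega>\<close> the negation can be replaced by the order-reversing relabelling
  \<open>\<omega>\<^sub>i \<mapsto> k + 1 - \<omega>\<^sub>i\<close>, which keeps coordinates positive and turns \<open>\<alpha>\<close> into \<open>rev \<alpha>\<close>.
\<close>

section \<open>Expansion in the monomial basis\<close>

lemma vec_monomial_eq_image_mset: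
  "vec_monomial w = image_mset (($) w) (mset_set (UNIV :: 'n::finite set))"
proof -
  have "(\<Sum>i\<in>X. {#w $ i#}) = image_mset (($) w) (mset_set X)" if "finite X" for X :: "'n set"
    using that by induction auto
  then show ?thesis by (simp add: vec_monomial_def)
qed

lemma set_mset_vec_monomial: "set_mset (vec_monomial w) = range (($) w)"
  by (simp add: vec_monomial_eq_image_mset)

lemma size_vec_monomial: "size (vec_monomial (w :: nat ^ 'n::finite)) = CARD('n)"
  by (simp add: vec_monomial_eq_image_mset)

lemma vec_monomial_relabel: "vec_monomial (\<chi> i. f (w $ i)) = image_mset f (vec_monomial w)"
  unfolding vec_monomial_eq_image_mset multiset.map_comp by (intro image_mset_cong) simp

text \<open>Applying \<open>f\<close> to every coordinate is a bijection between the two sets, with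
  inverse given by \<open>inv_into X f\<close>: a vector with monomial \<open>m\<close> has all its
  coordinates in \<open>X\<close>, where \<open>f\<close> is injective. It serves below for an
  increasing and for a decreasing \<open>f\<close>.\<close>

lemma card_vec_monomial_relabel:
  fixes A B :: "(nat ^ 'n::finite) set"
  assumes inj: "inj_on f X" and m: "set_mset m \<subseteq> X"
    and AB: "\<And>w. range (($) w) \<subseteq> X \<Longrightarrow> w \<in> A \<longleftrightarrow> (\<chi> i. f (w $ i)) \<in> B"
  shows "card {w \<in> A. vec_monomial w = m} = card {w \<in> B. vec_monomial w = image_mset f m}"
proof -
  let ?g = "inv_into X f"
  let ?F = "\<lambda>w :: nat ^ 'n. \<chi> i. f (w $ i)" and ?G = "\<lambda>w :: nat ^ 'n. \<chi> i. ?g (w $ i)"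
  have gf: "?g (f x) = x" if "x \<in> X" for x
    using inj that by simp
  have fg: "f (?g y) = y" "?g y \<in> X" if "y \<in> f ` set_mset m" for y
    using that m gf by auto
  have gm: "image_mset ?g (image_mset f m) = m"
  proof -
    have "image_mset ?g (image_mset f m) = image_mset (\<lambda>x. x) m"
      unfolding multiset.map_comp using m gf by (intro image_mset_cong) auto
    then show ?thesis by simp
  qed
  have r1: "w $ i \<in> X" if "vec_monomial w = m" for w i
    using that m set_mset_vec_monomial[of w] by auto
  have r2: "w $ i \<in> f ` set_mset m" if "vec_monomial w = image_mset f m" for w i
    using that set_mset_vec_monomial[of w] by (metis rangeI set_image_mset)
  let ?L = "{w \<in> A. vec_monomial w = m}" and ?R = "{w \<in> B. vec_monomial w = image_mset f m}"
  have "\<forall>w\<in>?L. ?G (?F w) = w"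
    by (auto simp: vec_eq_iff intro!: gf r1)
  moreover have FG: "\<forall>w\<in>?R. ?F (?G w) = w"
    by (auto simp: vec_eq_iff intro!: fg(1) r2)
  moreover have "?F w \<in> ?R" if "w \<in> ?L" for w
  proof -
    have "range (($) w) \<subseteq> X" using r1 that by blast
    then show ?thesis using AB that by (simp add: vec_monomial_relabel)
  qed
  then have "?F ` ?L \<subseteq> ?R" by blast
  moreover have "?G w \<in> ?L" if "w \<in> ?R" for w
  proof -
    have "range (($) (?G w)) \<subseteq> X" using that by (auto intro!: fg(2) r2)
    moreover have "?F (?G w) = w" using FG that by blast
    ultimately have "?G w \<in> A" using AB[of "?G w"] that by simp
    with that gm show ?thesis by (simp add: vec_monomial_relabel)
  qed
  then have "?G ` ?R \<subseteq> ?L" by blast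
  ultimately have "bij_betw ?F ?L ?R" by (rule bij_betw_byWitness)
  then show ?thesis by (rule bij_betw_same_card)
qed

section \<open>Monomials with prescribed exponents and their coefficients in
  \<open>M_\<alpha>\<close>\<close>

lemma power_monomial_map:
  "power_monomial \<alpha> (map f is) = image_mset f (power_monomial \<alpha> is)"
proof (induction "is" arbitrary: \<alpha>)
  case (Cons i "is")
  then show ?case by (cases \<alpha>) (auto simp: power_monomial_def)
qed (simp add: power_monomial_def)

lemma power_monomial_rev:
  "length is = length \<alpha> \<Longrightarrow> power_monomial (rev \<alpha>) (rev is) = power_monomial \<alpha> is"
  by (simp add: power_monomial_def zip_rev rev_map[symmetric] sum_list_rev)

lemma size_power_monomial: "length is = length \<alpha> \<Longrightarrow> size (power_monomial \<alpha> is) = sum_list \<alpha>"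
  by (induction "is" \<alpha> rule: list_induct2) (auto simp: power_monomial_def)

lemma power_monomial_count:
  assumes "distinct is" "set_mset m = set is"
  shows "power_monomial (map (count m) is) is = m"
proof -
  have "power_monomial (map (count m) is) is = (\<Sum>i\<leftarrow>is. replicate_mset (count m i) i)"
    by (simp add: power_monomial_def zip_map2 zip_same_conv_map comp_def)
  also have "\<dots> = (\<Sum>i\<in>set_mset m. replicate_mset (count m i) i)"
    using assms by (simp add: sum_list_distinct_conv_sum_set)
  also have "\<dots> = m"
    by (rule multiset_eqI) (simp add: count_sum not_in_iff)
  finally show ?thesis .
qed

text \<open>Extends \<open>monomial_qsym_packed\<close> to arbitrary positive increasing indices.
  The support of the monomial, listed increasingly, recovers the indices, and then the
  multiplicities recover the exponents.\<close>

lemma monomial_qsym_power_monomial: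
  assumes \<alpha>: "composition \<alpha>" and \<beta>: "composition \<beta>"
    and js: "length js = length \<alpha>" "sorted_wrt (<) js" "\<forall>j\<in>set js. 0 < j"
  shows "monomial_qsym \<beta> (power_monomial \<alpha> js) = (if \<alpha> = \<beta> then 1 else 0)"
proof -
  have "is = js \<and> \<alpha> = \<beta>"
    if l: "length is = length \<beta>" and s: "sorted_wrt (<) is"
      and e: "power_monomial \<beta> is = power_monomial \<alpha> js" for "is"
  proof -
    have "set is = set js"
      using set_power_monomial[OF \<beta> l] set_power_monomial[OF \<alpha> js(1)] e by simp
    then have "is = js"
      using s js(2) by (metis strict_sorted_equal)
    moreover have "distinct js" using js(2) by (simp add: strict_sorted_iff)
    ultimately show ?thesis
      using power_monomial_inj[of js \<alpha> \<beta>] l js(1) e by simp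
  qed
  then have "{is \<in> {is. length is = length \<beta> \<and> sorted_wrt (<) is \<and> (\<forall>i \<in> set is. 0 < i)}.
      power_monomial \<beta> is = power_monomial \<alpha> js} = (if \<alpha> = \<beta> then {js} else {})"
    using js by auto
  then show ?thesis
    unfolding monomial_qsym_def monomial_sum_def by simp
qed

text \<open>The support of a monomial of \<open>M_\<beta>\<close> is the set of its indices, and
  these are positive.\<close>

lemma monomial_qsym_index_0:
  assumes "composition \<beta>" "0 \<in># m"
  shows "monomial_qsym \<beta> m = 0"
proof -
  have "{is \<in> {is. length is = length \<beta> \<and> sorted_wrt (<) is \<and> (\<forall>i \<in> set is. 0 < i)}.
      power_monomial \<beta> is = m} = {}"
    using assms set_power_monomial[OF assms(1)] by fastforce
  then show ?thesis
    unfolding monomial_qsym_def monomial_sum_def by (simp only: card.empty of_nat_0)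
qed

text \<open>By \<open>monomial_qsym_packed\<close>, the coefficient of a quasisymmetric function at
  this monomial is its coefficient at \<open>M_\<alpha>\<close>.\<close>

definition packed_monomial :: "nat list \<Rightarrow> nat multiset" where
  "packed_monomial \<alpha> = power_monomial \<alpha> [1..<Suc (length \<alpha>)]"

section \<open>Compositions of fixed size and order-invariant sets of vectors\<close>

definition compositions_of :: "nat \<Rightarrow> nat list set" where
  "compositions_of n = {\<alpha>. composition \<alpha> \<and> sum_list \<alpha> = n}"

lemma finite_compositions_of: "finite (compositions_of n)"
proof -
  have "length \<alpha> \<le> sum_list \<alpha>" if "composition \<alpha>" for \<alpha>
    using that by (induction \<alpha>) (auto simp: composition_def)
  then have "compositions_of n \<subseteq> {\<alpha>. set \<alpha> \<subseteq> {..n} \<and> length \<alpha> \<le> n}"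
    by (auto simp: compositions_of_def member_le_sum_list)
  then show ?thesis
    by (rule finite_subset) (simp add: finite_lists_length_le)
qed

lemma rev_compositions_of: "rev \<alpha> \<in> compositions_of n \<longleftrightarrow> \<alpha> \<in> compositions_of n"
  by (simp add: compositions_of_def composition_def sum_list_rev)

text \<open>Strict comparisons of all pairs also determine the ties, so membership of a positive
  vector depends only on the weak ordering of its coordinates. This is what makes the associated sum
  of monomials quasisymmetric.\<close>

definition positive_order_invariant :: "(nat ^ 'n::finite) set \<Rightarrow> bool" where
  "positive_order_invariant A \<longleftrightarrow> (\<forall>w\<in>A. \<forall>i. 0 < w $ i) \<and>
     (\<forall>v w. (\<forall>i. 0 < v $ i) \<longrightarrow> (\<forall>i. 0 < w $ i) \<longrightarrow> (\<forall>i j. v $ i < v $ j \<longleftrightarrow> w $ i < w $ j) \<longrightarrow>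
       v \<in> A \<longrightarrow> w \<in> A)"

lemma positive_order_invariant_cong:
  assumes "positive_order_invariant A" "\<And>i. 0 < v $ i" "\<And>i. 0 < w $ i"
    and "\<And>i j. v $ i < v $ j \<longleftrightarrow> w $ i < w $ j"
  shows "v \<in> A \<longleftrightarrow> w \<in> A"
  using assms unfolding positive_order_invariant_def by metis

text \<open>The increasing map from \<open>1, ..., k\<close> to the entries of \<open>js\<close>
  carries one monomial to the other and keeps the relative order of the coordinates, hence
  membership in \<open>A\<close>.\<close>

lemma card_power_monomial_eq_packed:
  fixes A :: "(nat ^ 'n::finite) set"
  assumes A: "positive_order_invariant A" and \<alpha>: "composition \<alpha>"
    and js: "length js = length \<alpha>" "sorted_wrt (<) js" "\<forall>j\<in>set js. 0 < j"
  shows "card {w \<in> A. vec_monomial w = power_monomial \<alpha> js} =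
    card {w \<in> A. vec_monomial w = packed_monomial \<alpha>}"
proof -
  let ?p = "[1..<Suc (length \<alpha>)]"
  \<comment> \<open>List positions start at 0, packed indices at 1.\<close>
  let ?f = "\<lambda>x. js ! (x - 1)"
  have mono: "?f x < ?f y" if "x < y" "x \<in> set ?p" "y \<in> set ?p" for x y
    using that js by (intro sorted_wrt_nth_less[OF js(2)]) auto
  have iff: "?f x < ?f y \<longleftrightarrow> x < y" if "x \<in> set ?p" "y \<in> set ?p" for x y
    using mono[of x y] mono[of y x] that by (metis not_less_iff_gr_or_eq)
  have pos: "0 < ?f x" "0 < x" if "x \<in> set ?p" for x
    using that js by auto
  have map: "map ?f ?p = js"
    using js(1) by (intro nth_equalityI) (auto simp del: upt_Suc)
  have "card {w \<in> A. vec_monomial w = packed_monomial \<alpha>} =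
      card {w \<in> A. vec_monomial w = image_mset ?f (packed_monomial \<alpha>)}"
  proof (rule card_vec_monomial_relabel)
    show "inj_on ?f (set ?p)"
      using mono by (intro linorder_inj_onI) (auto simp: less_imp_neq simp del: upt_Suc)
    show "set_mset (packed_monomial \<alpha>) \<subseteq> set ?p"
      unfolding packed_monomial_def by (subst set_power_monomial[OF \<alpha>]) (auto simp: Suc_le_eq)
  next
    fix w :: "nat ^ 'n" assume "range (($) w) \<subseteq> set ?p"
    then have w: "w $ i \<in> set ?p" for i by blast
    show "w \<in> A \<longleftrightarrow> (\<chi> i. ?f (w $ i)) \<in> A"
      using positive_order_invariant_cong[OF A, of w "\<chi> i. ?f (w $ i)"] iff[OF w w] pos[OF w]
      by (simp only: vec_lambda_beta simp_thms)
  qed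
  then show ?thesis
    unfolding packed_monomial_def power_monomial_map[symmetric] map by simp
qed

text \<open>Coefficients are compared at each monomial. If index 0 occurs, both sides vanish;
  otherwise at most one \<open>M_\<beta>\<close> contributes, and its coefficient may be read off at
  the packed monomial.\<close>

lemma monomial_sum_vec_monomial_expansion:
  fixes A :: "(nat ^ 'n::finite) set"
  assumes A: "positive_order_invariant A"
  shows "monomial_sum vec_monomial A = (\<Sum>\<alpha>\<in>compositions_of CARD('n).
    qscale (of_nat (card {w \<in> A. vec_monomial w = packed_monomial \<alpha>})) (monomial_qsym \<alpha>))"
proof
  fix m
  let ?c = "\<lambda>\<alpha>. of_nat (card {w \<in> A. vec_monomial w = packed_monomial \<alpha>}) :: int poly"
  let ?T = "compositions_of CARD('n)"
  have "monomial_sum vec_monomial A m = (\<Sum>\<beta>\<in>?T. ?c \<beta> * monomial_qsym \<beta> m)"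
  proof (cases "0 \<in># m")
    case True
    have "{w \<in> A. vec_monomial w = m} = {}"
    proof -
      have "0 \<notin># vec_monomial w" if "w \<in> A" for w
      proof -
        have "\<forall>i. 0 < w $ i" using that A unfolding positive_order_invariant_def by blast
        then show ?thesis unfolding set_mset_vec_monomial by (metis imageE less_irrefl)
      qed
      with True show ?thesis by blast
    qed
    then have "monomial_sum vec_monomial A m = 0"
      unfolding monomial_sum_def by (simp only: card.empty of_nat_0)
    then show ?thesis
      using True by (simp add: monomial_qsym_index_0 compositions_of_def)
  next
    case False
    define js where "js = sorted_list_of_set (set_mset m)"
    define \<alpha> where "\<alpha> = map (count m) js"
    have set_js: "set js = set_mset m" and dist: "distinct js" by (simp_all add: js_def)
    have js: "length js = length \<alpha>" "sorted_wrt (<) js" "\<forall>j\<in>set js. 0 < j"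
      using False unfolding set_js by (auto simp: js_def \<alpha>_def intro: gr0I)
    have \<alpha>: "composition \<alpha>"
      by (auto simp: composition_def \<alpha>_def set_js)
    have m: "m = power_monomial \<alpha> js"
      using power_monomial_count[OF dist set_js[symmetric]] by (simp add: \<alpha>_def)
    \<comment> \<open>Vector monomials have degree \<open>CARD('n)\<close>, so a composition of any
      other size gets coefficient 0, in agreement with its absence from \<open>?T\<close>.\<close>
    have c0: "?c \<alpha> = 0" if "\<alpha> \<notin> ?T"
    proof -
      have "size (packed_monomial \<alpha>) \<noteq> CARD('n)"
        using that \<alpha> by (simp add: packed_monomial_def size_power_monomial compositions_of_def del: upt_Suc)
      then have "{w \<in> A. vec_monomial w = packed_monomial \<alpha>} = {}"
        using size_vec_monomial[where 'n = 'n] by (metis (mono_tags, lifting) empty_Collect_eq)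
      then show ?thesis by (simp only: card.empty of_nat_0)
    qed
    have "(\<Sum>\<beta>\<in>?T. ?c \<beta> * monomial_qsym \<beta> m) = (\<Sum>\<beta>\<in>?T. if \<beta> = \<alpha> then ?c \<beta> else 0)"
      unfolding m using \<alpha> js
      by (intro sum.cong refl)
        (auto simp: monomial_qsym_power_monomial compositions_of_def)
    also have "\<dots> = ?c \<alpha>"
      using c0 by (simp add: finite_compositions_of)
    finally show ?thesis
      using card_power_monomial_eq_packed[OF A \<alpha> js] by (simp add: monomial_sum_def m)
  qed
  then show "monomial_sum vec_monomial A m = (\<Sum>\<alpha>\<in>?T. qscale (?c \<alpha>) (monomial_qsym \<alpha>)) m"
    by (simp add: sum_qseries_apply qscale_def)
qed

section \<open>Reversal\<close>

lemma monomial_qsym_in_qsym: "composition \<alpha> \<Longrightarrow> monomial_qsym \<alpha> \<in> qsym"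
  unfolding qsym_def qsym_basis_def by (intro qser.span_base) blast

lemma qscale_in_qsym: "F \<in> qsym \<Longrightarrow> qscale c F \<in> qsym"
  unfolding qsym_def by (rule qser.span_scale)

lemma sum_in_qsym: "(\<And>a. a \<in> S \<Longrightarrow> F a \<in> qsym) \<Longrightarrow> sum F S \<in> qsym"
  unfolding qsym_def by (rule qser.span_sum)

lemma qsym_rev_sum:
  assumes "finite S" "\<And>a. a \<in> S \<Longrightarrow> F a \<in> qsym"
  shows "qsym_rev (sum F S) = (\<Sum>a\<in>S. qsym_rev (F a))"
  using assms
proof (induction S)
  case empty
  have "0 \<in> qsym" unfolding qsym_def by (rule qser.span_zero)
  \<comment> \<open>The empty sum is handled by scaling the zero series by 0.\<close>
  from qsym_rev_scale[OF this, of 0] show ?case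
    by (simp only: qser.scale_zero_left sum.empty)
next
  case (insert a S)
  then have "qsym_rev (F a + sum F S) = qsym_rev (F a) + (\<Sum>a\<in>S. qsym_rev (F a))"
    by (subst qsym_rev_add) (simp_all add: sum_in_qsym)
  then show ?case
    unfolding sum.insert[OF insert.hyps] .
qed

text \<open>The relabelling \<open>Suc ?k - x\<close> permutes \<open>1, ..., k\<close> and reverses
  the order, so it pairs vectors of \<open>A\<close> with vectors of \<open>B\<close>. It turns the
  index list around, which has the same effect as reversing the exponents.\<close>

lemma card_packed_monomial_rev:
  fixes A B :: "(nat ^ 'n::finite) set"
  assumes \<alpha>: "composition \<alpha>"
    and AB: "\<And>v w. \<forall>i. 0 < v $ i \<Longrightarrow> \<forall>i. 0 < w $ i \<Longrightarrow> \<forall>i j. v $ i < v $ j \<longleftrightarrow> w $ j < w $ i \<Longrightarrow>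
      v \<in> A \<longleftrightarrow> w \<in> B"
  shows "card {w \<in> B. vec_monomial w = packed_monomial (rev \<alpha>)} =
    card {w \<in> A. vec_monomial w = packed_monomial \<alpha>}"
proof -
  let ?k = "length \<alpha>"
  let ?p = "[1..<Suc ?k]"
  let ?f = "\<lambda>x. Suc ?k - x"
  have map: "map ?f ?p = rev ?p"
    by (rule nth_equalityI) (auto simp: rev_nth simp del: upt_Suc)
  have "card {w \<in> A. vec_monomial w = packed_monomial \<alpha>} =
      card {w \<in> B. vec_monomial w = image_mset ?f (packed_monomial \<alpha>)}"
  proof (rule card_vec_monomial_relabel)
    show "inj_on ?f (set ?p)" by (auto simp: inj_on_def)
    show "set_mset (packed_monomial \<alpha>) \<subseteq> set ?p"
      unfolding packed_monomial_def by (subst set_power_monomial[OF \<alpha>]) (auto simp: Suc_le_eq)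
  next
    fix w :: "nat ^ 'n" assume "range (($) w) \<subseteq> set ?p"
    then have "w $ i \<in> set ?p" for i by blast
    then have "0 < w $ i" "w $ i \<le> ?k" for i
      unfolding set_upt by (simp_all add: Suc_le_eq less_Suc_eq_le)
    then show "w \<in> A \<longleftrightarrow> (\<chi> i. ?f (w $ i)) \<in> B"
      by (intro AB) (auto simp: less_Suc_eq_le intro!: diff_less_mono2)
  qed
  also have "image_mset ?f (packed_monomial \<alpha>) = packed_monomial (rev \<alpha>)"
    unfolding packed_monomial_def power_monomial_map[symmetric] map
    \<comment> \<open>Reversing indices and exponents together leaves a monomial unchanged, so the
      reversal moves from \<open>?p\<close> to \<open>\<alpha>\<close>.\<close>
    using power_monomial_rev[of "rev ?p" \<alpha>] by (simp del: upt_Suc)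
  finally show ?thesis by simp
qed

lemma monomial_sum_vec_monomial_in_qsym:
  assumes "positive_order_invariant A"
  shows "monomial_sum vec_monomial A \<in> qsym"
  unfolding monomial_sum_vec_monomial_expansion[OF assms]
  by (intro sum_in_qsym qscale_in_qsym monomial_qsym_in_qsym) (simp add: compositions_of_def)

text \<open>In the two expansions the coefficient of \<open>M_\<alpha>\<close> for \<open>A\<close>
  equals that of \<open>M_(rev \<alpha>)\<close> for \<open>B\<close>; reindexing by
  \<open>rev\<close> matches the sums.\<close>

lemma qsym_rev_monomial_sum:
  fixes A B :: "(nat ^ 'n::finite) set"
  assumes A: "positive_order_invariant A" and B: "positive_order_invariant B"
    and AB: "\<And>v w. \<forall>i. 0 < v $ i \<Longrightarrow> \<forall>i. 0 < w $ i \<Longrightarrow> \<forall>i j. v $ i < v $ j \<longleftrightarrow> w $ j < w $ i \<Longrightarrow>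
      v \<in> A \<longleftrightarrow> w \<in> B"
  shows "qsym_rev (monomial_sum vec_monomial A) = monomial_sum vec_monomial B"
proof -
  let ?T = "compositions_of CARD('n)"
  let ?c = "\<lambda>A \<alpha>. of_nat (card {w :: nat ^ 'n. w \<in> A \<and> vec_monomial w = packed_monomial \<alpha>}) :: int poly"
  have comp: "composition \<alpha>" if "\<alpha> \<in> ?T" for \<alpha>
    using that by (simp add: compositions_of_def)
  have "qsym_rev (monomial_sum vec_monomial A) =
      (\<Sum>\<alpha>\<in>?T. qsym_rev (qscale (?c A \<alpha>) (monomial_qsym \<alpha>)))"
    unfolding monomial_sum_vec_monomial_expansion[OF A]
    by (intro qsym_rev_sum finite_compositions_of qscale_in_qsym monomial_qsym_in_qsym comp)
  also have "\<dots> = (\<Sum>\<alpha>\<in>?T. qscale (?c B (rev \<alpha>)) (monomial_qsym (rev \<alpha>)))"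
  proof (intro sum.cong refl)
    fix \<alpha> assume "\<alpha> \<in> ?T"
    note \<alpha> = comp[OF this]
    have "?c B (rev \<alpha>) = ?c A \<alpha>"
      by (rule arg_cong[where f = of_nat], rule card_packed_monomial_rev[OF \<alpha>]) (rule AB)
    then show "qsym_rev (qscale (?c A \<alpha>) (monomial_qsym \<alpha>)) =
        qscale (?c B (rev \<alpha>)) (monomial_qsym (rev \<alpha>))"
      using \<alpha> by (simp add: qsym_rev_scale monomial_qsym_in_qsym qsym_rev_monomial_qsym)
  qed
  also have "\<dots> = (\<Sum>\<alpha>\<in>?T. qscale (?c B \<alpha>) (monomial_qsym \<alpha>))"
    by (rule sum.reindex_bij_witness[of _ rev rev]) (auto simp: rev_compositions_of)
  also have "\<dots> = monomial_sum vec_monomial B"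
    by (rule monomial_sum_vec_monomial_expansion[OF B, symmetric])
  finally show ?thesis .
qed

section \<open>Normal cones of poset cones\<close>

definition poset_gens :: "'n::finite rel \<Rightarrow> (real ^ 'n) set" where
  "poset_gens P = {axis i 1 - axis j 1 | i j. (i, j) \<in> P \<and> i \<noteq> j}"

lemma poset_cone_eq: "poset_cone P = convex_cone hull poset_gens P"
  by (simp add: poset_cone_def poset_gens_def)

lemma finite_poset_gens: "finite (poset_gens P)"
proof -
  have "poset_gens P \<subseteq> (\<lambda>(i, j). axis i 1 - axis j 1) ` UNIV"
    by (auto simp: poset_gens_def)
  then show ?thesis by (rule finite_subset) simp
qed

lemma finite_faces_poset_cone: "finite {G. G face_of poset_cone P}"
  unfolding poset_cone_eq
  by (intro finite_polyhedron_faces polyhedron_convex_cone_hull finite_poset_gens)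

text \<open>A functional takes the value \<open>w $ i - w $ j\<close> at the generator
  \<open>e_i - e_j\<close>. If it is bounded above on the cone, its maximizers are the points where
  it vanishes, so only the signs of these differences matter.\<close>

lemma open_normal_cone_order_mono:
  fixes u v :: "real ^ 'n::finite"
  assumes uv: "\<And>i j. u $ i < u $ j \<longleftrightarrow> v $ i < v $ j"
    and G: "G face_of poset_cone P" "G \<noteq> {}"
    and u: "u \<in> open_normal_cone (poset_cone P) G"
  shows "v \<in> open_normal_cone (poset_cone P) G"
proof -
  let ?C = "poset_cone P"
  let ?T = "{x. u \<bullet> x \<le> 0 \<and> v \<bullet> x \<le> 0 \<and> (u \<bullet> x = 0 \<longleftrightarrow> v \<bullet> x = 0)}"
  have cone0: "0 \<in> ?C" unfolding poset_cone_eq by (rule convex_cone_hull_contains_0)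
  have cone2: "2 *\<^sub>R x \<in> ?C" if "x \<in> ?C" for x
    using that unfolding poset_cone_eq by (rule convex_cone_hull_mul) simp
  \<comment> \<open>A maximizer \<open>g\<close> is compared with \<open>2 *\<^sub>R g\<close> and
    with 0, both in the cone.\<close>
  have zero: "w \<bullet> g = 0" if "g \<in> ?C" "\<forall>y\<in>?C. w \<bullet> y \<le> w \<bullet> g" for w g
  proof -
    have "w \<bullet> (2 *\<^sub>R g) \<le> w \<bullet> g" "w \<bullet> 0 \<le> w \<bullet> g"
      using that cone0 cone2 by blast+
    then show ?thesis by simp
  qed
  note eq = open_normal_cone_eq_maximizers[OF finite_poset_gens poset_cone_eq G]
  have uG: "{x \<in> ?C. \<forall>y\<in>?C. u \<bullet> y \<le> u \<bullet> x} = G" using u unfolding eq by simp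
  then obtain g where "g \<in> ?C" "\<forall>y\<in>?C. u \<bullet> y \<le> u \<bullet> g" using G(2) by blast
  with zero have u0: "\<forall>y\<in>?C. u \<bullet> y \<le> 0" by metis
  txt \<open>The functionals \<open>u\<close> and \<open>v\<close> have the same signs on the generators, and the vectors on which
    both are nonpositive and vanish simultaneously form a convex cone.\<close>
  have "poset_gens P \<subseteq> ?T"
  proof
    fix x assume x: "x \<in> poset_gens P"
    then obtain i j where ij: "x = axis i 1 - axis j 1" by (auto simp: poset_gens_def)
    have "x \<in> ?C" using x unfolding poset_cone_eq by (rule hull_inc)
    then have "u \<bullet> x \<le> 0" using u0 by blast
    then show "x \<in> ?T"
      \<comment> \<open>The pair \<open>(j, i)\<close> transfers nonpositivity; both pairs together
        transfer equality of the two coordinates.\<close>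
      using uv[of i j] uv[of j i] by (auto simp: ij inner_diff_right inner_axis)
  qed
  \<comment> \<open>For closure under addition: two nonpositive numbers sum to 0 only if both are
    0.\<close>
  moreover have "convex_cone ?T"
    by (auto simp: convex_cone_iff inner_add_right mult_nonneg_nonpos add_nonpos_nonpos
        add_nonpos_eq_0_iff)
  ultimately have CT: "?C \<subseteq> ?T"
    unfolding poset_cone_eq by (rule hull_minimal)
  have "{x \<in> ?C. \<forall>y\<in>?C. w \<bullet> y \<le> w \<bullet> x} = {x \<in> ?C. w \<bullet> x = 0}" if "\<forall>y\<in>?C. w \<bullet> y \<le> 0" for w
    using that zero[of _ w] by auto
  then have "{x \<in> ?C. \<forall>y\<in>?C. v \<bullet> y \<le> v \<bullet> x} = {x \<in> ?C. \<forall>y\<in>?C. u \<bullet> y \<le> u \<bullet> x}"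
    using CT u0 by (smt (verit) Collect_cong mem_Collect_eq subset_iff)
  with uG show ?thesis unfolding eq by simp
qed

lemma open_normal_cone_order_cong:
  fixes u v :: "real ^ 'n::finite"
  assumes "\<And>i j. u $ i < u $ j \<longleftrightarrow> v $ i < v $ j"
    and "G face_of poset_cone P" "G \<noteq> {}"
  shows "u \<in> open_normal_cone (poset_cone P) G \<longleftrightarrow> v \<in> open_normal_cone (poset_cone P) G"
  using open_normal_cone_order_mono assms by metis

section \<open>Negation and the opposite poset\<close>

lemma mem_uminus_image: "x \<in> uminus ` S \<longleftrightarrow> - x \<in> S" for x :: "'a::group_add"
  by (metis imageE imageI minus_minus)

lemma poset_gens_converse: "poset_gens (P\<inverse>) = uminus ` poset_gens P"
proof -
  have *: "- x \<in> poset_gens (Q\<inverse>)" if x: "x \<in> poset_gens Q" for x and Q :: "'a rel"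
  proof -
    obtain i j where "x = axis i 1 - axis j 1" "(i, j) \<in> Q" "i \<noteq> j"
      using x unfolding poset_gens_def by blast
    then have "- x = axis j 1 - axis i 1" "(j, i) \<in> Q\<inverse>" "j \<noteq> i" by simp_all
    then show ?thesis unfolding poset_gens_def by blast
  qed
  have "x \<in> poset_gens (P\<inverse>) \<longleftrightarrow> - x \<in> poset_gens P" for x
    using *[of x "P\<inverse>"] *[of "- x" P] by (metis converse_converse minus_minus)
  then show ?thesis by (intro set_eqI) (simp only: mem_uminus_image)
qed

lemma poset_cone_converse: "poset_cone (P\<inverse>) = uminus ` poset_cone P"
  unfolding poset_cone_eq poset_gens_converse
  by (intro convex_cone_hull_linear_image linear_uminus)

text \<open>Negating both arguments preserves the inner product, and relative interiors commute with
  injective linear maps.\<close>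

lemma open_normal_cone_uminus:
  fixes C G :: "'a::euclidean_space set"
  shows "open_normal_cone (uminus ` C) (uminus ` G) = uminus ` open_normal_cone C G"
proof -
  have "normal_cone (uminus ` C) (uminus ` G) = uminus ` normal_cone C G"
    by (rule set_eqI) (simp add: mem_uminus_image normal_cone_def)
  then show ?thesis
    unfolding open_normal_cone_def
    by (simp only: rel_interior_injective_linear_image
        bounded_linear_minus[OF bounded_linear_ident] inj_uminus)
qed

text \<open>These vectors index the inner sum of \<open>weighted_enumerator\<close> at the face
  \<open>G\<close>.\<close>

definition dual_vectors :: "(real ^ 'n::finite) set \<Rightarrow> (real ^ 'n) set \<Rightarrow> (nat ^ 'n) set" where
  "dual_vectors C G = {w. (\<forall>i. 0 < w $ i) \<and> (\<chi> i. real (w $ i)) \<in> open_normal_cone C G}"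

lemma positive_order_invariant_dual_vectors:
  fixes P :: "'a::finite rel"
  assumes "G face_of poset_cone P" "G \<noteq> {}"
  shows "positive_order_invariant (dual_vectors (poset_cone P) G)"
  unfolding positive_order_invariant_def
proof (intro conjI allI impI)
  fix v w :: "nat ^ 'a"
  assume "\<forall>i. 0 < w $ i" "\<forall>i j. v $ i < v $ j \<longleftrightarrow> w $ i < w $ j"
    and "v \<in> dual_vectors (poset_cone P) G"
  then show "w \<in> dual_vectors (poset_cone P) G"
    using open_normal_cone_order_mono[OF _ assms, of "\<chi> i. real (v $ i)" "\<chi> i. real (w $ i)"]
    by (simp add: dual_vectors_def)
qed (simp add: dual_vectors_def)

lemma qsym_rev_dual_vectors:
  fixes P :: "'n::finite rel"
  assumes G: "G face_of poset_cone P" "G \<noteq> {}"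
  shows "qsym_rev (monomial_sum vec_monomial (dual_vectors (poset_cone P) G)) =
    monomial_sum vec_monomial (dual_vectors (poset_cone (P\<inverse>)) (uminus ` G))"
proof (rule qsym_rev_monomial_sum)
  show "positive_order_invariant (dual_vectors (poset_cone P) G)"
    by (rule positive_order_invariant_dual_vectors[OF G])
  have "uminus ` G face_of poset_cone (P\<inverse>)"
    unfolding poset_cone_converse using G(1) by (simp add: face_of_linear_image linear_uminus)
  then show "positive_order_invariant (dual_vectors (poset_cone (P\<inverse>)) (uminus ` G))"
    using G(2) by (intro positive_order_invariant_dual_vectors) auto
next
  fix v w :: "nat ^ 'n"
  assume vw: "\<forall>i. 0 < v $ i" "\<forall>i. 0 < w $ i" "\<forall>i j. v $ i < v $ j \<longleftrightarrow> w $ j < w $ i"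
  \<comment> \<open>The vectors \<open>v\<close> and \<open>-w\<close> have the same relative order.
    As \<open>-w\<close> has negative coordinates, the comparison takes place among real
    vectors.\<close>
  have "(\<chi> i. real (v $ i)) \<in> open_normal_cone (poset_cone P) G \<longleftrightarrow>
      - (\<chi> i. real (w $ i)) \<in> open_normal_cone (poset_cone P) G"
    using vw(3) by (intro open_normal_cone_order_cong[OF _ G]) simp
  also have "\<dots> \<longleftrightarrow> (\<chi> i. real (w $ i)) \<in> open_normal_cone (poset_cone (P\<inverse>)) (uminus ` G)"
    unfolding poset_cone_converse open_normal_cone_uminus by (simp only: mem_uminus_image)
  finally show "v \<in> dual_vectors (poset_cone P) G \<longleftrightarrow>
      w \<in> dual_vectors (poset_cone (P\<inverse>)) (uminus ` G)"
    using vw(1,2) by (simp add: dual_vectors_def)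
qed

lemma aff_dim_uminus: "aff_dim (uminus ` G) = aff_dim (G :: 'a::euclidean_space set)"
  by (rule aff_dim_injective_linear_image) (simp_all add: linear_uminus)

theorem proposition4p8:
  fixes P :: "'n::finite rel"
  assumes "partial_order_on UNIV P"
  shows "weighted_enumerator (poset_cone (P\<inverse>)) = qsym_rev (weighted_enumerator (poset_cone P))"
proof -
  let ?\<F> = "\<lambda>P :: 'n rel. {G. G face_of poset_cone P \<and> G \<noteq> {}}"
  let ?t = "\<lambda>(P :: 'n rel) G. qscale (monom 1 (nat (aff_dim G)))
    (monomial_sum vec_monomial (dual_vectors (poset_cone P) G))"
  have W: "weighted_enumerator (poset_cone Q) = sum (?t Q) (?\<F> Q)" for Q :: "'n rel"
    unfolding weighted_enumerator_def dual_vectors_def ..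
  have in_qsym: "monomial_sum vec_monomial (dual_vectors (poset_cone P) G) \<in> qsym"
    if "G \<in> ?\<F> P" for G
    using that by (intro monomial_sum_vec_monomial_in_qsym positive_order_invariant_dual_vectors) auto
  have "qsym_rev (weighted_enumerator (poset_cone P)) = (\<Sum>G\<in>?\<F> P. qsym_rev (?t P G))"
    unfolding W
  proof (rule qsym_rev_sum)
    show "finite (?\<F> P)" using finite_faces_poset_cone by (rule rev_finite_subset) blast
  qed (intro qscale_in_qsym in_qsym)
  \<comment> \<open>Negation preserves the dimension of a face, so the power of \<open>q\<close> is
    unchanged.\<close>
  also have "\<dots> = (\<Sum>G\<in>?\<F> P. ?t (P\<inverse>) (uminus ` G))"
    using in_qsym by (intro sum.cong refl) (simp add: qsym_rev_scale qsym_rev_dual_vectors aff_dim_uminus)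
  also have "\<dots> = sum (?t (P\<inverse>)) (?\<F> (P\<inverse>))"
  \<comment> \<open>Negation of sets is its own inverse and exchanges the nonempty faces of the two
    cones.\<close>
  proof (rule sum.reindex_bij_witness[of _ "(`) uminus" "(`) uminus"])
    have "uminus ` G \<in> ?\<F> (Q\<inverse>)" if "G \<in> ?\<F> Q" for G and Q :: "'n rel"
      using that by (simp add: poset_cone_converse face_of_linear_image linear_uminus)
    from this[of _ P] this[of _ "P\<inverse>"]
    show "\<And>G. G \<in> ?\<F> P \<Longrightarrow> uminus ` G \<in> ?\<F> (P\<inverse>)" "\<And>G. G \<in> ?\<F> (P\<inverse>) \<Longrightarrow> uminus ` G \<in> ?\<F> P"
      by simp_all
  qed (simp_all add: image_image)
  finally show ?thesis unfolding W by simp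
qed

end
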